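(* Let $C_k=\{S_k\ne S_{k-1}\}$ for $k\ge1$, and define the adaptation times $\tau_1=\inf\{k\ge1: C_k\text{ occurs}\}$ and $\tau_j=\inf\{k>\tau_{j-1}: C_k\text{ occurs}\}$ for $j\ge2$, with $\tau_j=\infty$ if $\tau_{j-1}=\infty$ or if no such $k$ exists. Suppose that for some $p>0$ one of the following holds: $$\sum_{k=1}^\infty\frac{\mathbb{P}(C_k)}{k^p}<\infty\qquad\text{or}\qquad\sum_{j=1}^\infty\mathbb{E}\big[\tau_j^{-p}\big]<\infty .$$ Then the adaptation is strongly $p$-waning.
   Context: $(\mathbb{X},\mathcal{X})$ and $(\mathbb{S},\mathcal{S})$ are measurable spaces. $\pi$ is a probability measure on $\mathbb{X}$ and $\{P_s\}_{s\in\mathbb{S}}$ is a family of Markov transition probabilities on $\mathbb{X}$, each $\pi$-invariant, such that $(s,x)\mapsto P_s(x,A)$ is $\mathcal{S}\otimes\mathcal{X}$-measurable for all $A\in\mathcal{X}$. $(S_k,X_k)_{k\ge0}$ is an $\mathbb{S}\times\mathbb{X}$-valued stochastic process adapted to a filtration $(\mathcal{F}_k)_{k\ge0}$ such that for all $k\ge0$ and $A\in\mathcal{X}$, $\mathbb{P}(X_{k+1}\in A\mid\mathcal{F}_k)=P_{S_k}(X_k,A)$ a.s. The sets $\{S_k\ne S_{k-1}\}$ are events (measurable), and $\infty^{-p}=0$. Strongly $p$-waning means: there are random variables $D_k$, $k\ge1$, with values in $[0,1]$ such that $\sup_{x\in\mathbb{X}}d_{\mathrm{tv}}\big(P_{S_k}(x,\cdot),P_{S_{k-1}}(x,\cdot)\big)\le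 D_k$ for all $k\ge1$, and $n^{-p}\sum_{k=1}^nD_k\to0$ almost surely as $n\to\infty$. Here $d_{\mathrm{tv}}(\mu,\nu)=\sup_A|\mu(A)-\nu(A)|$. *)

theory Defs
  imports "HOL-Probability.Probability" "HOL-Library.Extended_Nat"
begin

text \<open>
  The measurable spaces are given by the \<open>sets\<close> and \<open>space\<close> of \<open>XX\<close> and \<open>SS\<close>, the members of
  the filtration by those of \<open>F k\<close>; the measures these carry are irrelevant.
\<close>

definition change_event :: "'w measure \<Rightarrow> (nat \<Rightarrow> 'w \<Rightarrow> 's) \<Rightarrow> nat \<Rightarrow> 'w set" where
  "change_event M S k = {\<omega> \<in> space M. S k \<omega> \<noteq> S (k - 1) \<omega>}"

locale adaptive_process =
  prob_space M + filtration "space M" F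
  for M :: "'w measure" and F :: "nat \<Rightarrow> 'w measure" +
  fixes XX :: "'x measure" and SS :: "'s measure"
    and \<pi> :: "'x measure" and P :: "'s \<Rightarrow> 'x \<Rightarrow> 'x measure"
    and S :: "nat \<Rightarrow> 'w \<Rightarrow> 's" and X :: "nat \<Rightarrow> 'w \<Rightarrow> 'x"
  assumes F_subalgebra: "\<And>k. subalgebra M (F k)"
    and target_prob: "prob_space \<pi>" and sets_target: "sets \<pi> = sets XX"
    and kernel: "\<And>s. s \<in> space SS \<Longrightarrow> P s \<in> XX \<rightarrow>\<^sub>M prob_algebra XX"
    and kernel_jointly_measurable:
      "\<And>A. A \<in> sets XX \<Longrightarrow> (\<lambda>(s, x). measure (P s x) A) \<in> borel_measurable (SS \<Otimes>\<^sub>M XX)"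
    and kernel_invariant: "\<And>s. s \<in> space SS \<Longrightarrow> \<pi> \<bind> P s = \<pi>"
    and adapted: "\<And>k. (\<lambda>\<omega>. (S k \<omega>, X k \<omega>)) \<in> F k \<rightarrow>\<^sub>M SS \<Otimes>\<^sub>M XX"
    and transition:
      "\<And>k A. A \<in> sets XX \<Longrightarrow>
         AE \<omega> in M. real_cond_exp M (F k) (\<lambda>\<omega>. indicator A (X (Suc k) \<omega>)) \<omega>
                      = measure (P (S k \<omega>) (X k \<omega>)) A"
    and change_measurable:
      "\<And>k. k \<ge> 1 \<Longrightarrow> change_event M S k \<in> sets M"

text \<open>
  Both real suprema below range over nonempty sets bounded by 1 whenever the measures are
  probability measures on a common (nonempty) measurable space.
\<close>

definition tv_dist :: "'x measure \<Rightarrow> 'x measure \<Rightarrow> real" where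
  "tv_dist \<mu> \<nu> = (SUP A\<in>sets \<mu>. \<bar>measure \<mu> A - measure \<nu> A\<bar>)"

definition strongly_waning ::
  "'w measure \<Rightarrow> 'x measure \<Rightarrow> ('s \<Rightarrow> 'x \<Rightarrow> 'x measure) \<Rightarrow> (nat \<Rightarrow> 'w \<Rightarrow> 's) \<Rightarrow> real \<Rightarrow> bool" where
  "strongly_waning M XX P S p \<longleftrightarrow>
     (\<exists>D :: nat \<Rightarrow> 'w \<Rightarrow> real.
        (\<forall>k\<ge>1. D k \<in> borel_measurable M \<and>
           (\<forall>\<omega>\<in>space M. 0 \<le> D k \<omega> \<and> D k \<omega> \<le> 1 \<and>
              (SUP x\<in>space XX. tv_dist (P (S k \<omega>) x) (P (S (k - 1) \<omega>) x)) \<le> D k \<omega>)) \<and>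
        (AE \<omega> in M. (\<lambda>n. real n powr (- p) * (\<Sum>k=1..n. D k \<omega>)) \<longlonglongrightarrow> 0))"

text \<open>
  The auxiliary value at index 0 makes the first adaptation time an instance of the recursion:
  \<open>k > 0\<close> is \<open>k \<ge> 1\<close>. On \<open>enat\<close> the infimum of the empty set is \<open>\<infinity>\<close>, and \<open>\<infinity> < enat k\<close> never holds.
\<close>

fun adaptation_time :: "(nat \<Rightarrow> 'w \<Rightarrow> 's) \<Rightarrow> nat \<Rightarrow> 'w \<Rightarrow> enat" where
  "adaptation_time S 0 \<omega> = 0"
| "adaptation_time S (Suc j) \<omega> =
     Inf {enat k | k. adaptation_time S j \<omega> < enat k \<and> S k \<omega> \<noteq> S (k - 1) \<omega>}"

definition enat_neg_powr :: "enat \<Rightarrow> real \<Rightarrow> real" where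
  "enat_neg_powr t p = (case t of enat n \<Rightarrow> real n powr (- p) | \<infinity> \<Rightarrow> 0)"

end

theory Submission
  imports Defs
begin

text \<open>
  Take for \<open>D k\<close> the indicator of \<open>C k\<close>. Every \<open>k\<close> for which \<open>C k\<close> occurs is one of the finite
  adaptation times, and distinct \<open>k\<close> are distinct adaptation times, so pathwise
  \<open>\<Sum>k. D k / k powr p\<close> is at most the sum of the negative powers of the adaptation times. Either
  hypothesis thus gives \<open>\<Sum>k. D k / k powr p\<close> a finite expectation; it is then almost surely finite,
  and dominated convergence of series (Kronecker's lemma for nonnegative terms) yields the claim.
\<close>

section \<open>Kronecker's lemma for nonnegative terms\<close>

lemma kronecker_powr_nonneg:
  fixes a :: "nat \<Rightarrow> real"
  assumes nonneg: "\<And>k. 0 \<le> a k" and p: "p > 0"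
    and summable: "summable (\<lambda>k. a (Suc k) / real (Suc k) powr p)"
  shows "(\<lambda>n. real n powr (- p) * (\<Sum>k=1..n. a k)) \<longlonglongrightarrow> 0"
proof -
  \<comment> \<open>Extending the finite sum by zeros turns the scaled partial sum into a series
    over all \<open>k\<close>, so that Tannery's theorem can exchange limit and sum. The index is
    shifted: \<open>f k n\<close> carries the term \<open>a (Suc k)\<close>.\<close>
  define f where "f k n = (if k < n then real n powr (- p) * a (Suc k) else 0)" for k n
  have lim: "(\<lambda>n. f k n) \<longlonglongrightarrow> 0" for k
  proof (rule Lim_null_comparison)
    show "\<forall>\<^sub>F n in sequentially. norm (f k n) \<le> real n powr (- p) * a (Suc k)"
      using nonneg by (auto simp: f_def)
    have "(\<lambda>n. real n powr (- p)) \<longlonglongrightarrow> 0"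
      using p by (intro tendsto_neg_powr filterlim_real_sequentially) auto
    then show "(\<lambda>n. real n powr (- p) * a (Suc k)) \<longlonglongrightarrow> 0"
      by (rule tendsto_mult_left_zero)
  qed
  \<comment> \<open>Domination uniform in \<open>n\<close>: a nonzero term has
    \<open>Suc k \<le> n\<close>, and \<open>powr (- p)\<close> is decreasing.\<close>
  have bound: "norm (f k n) \<le> a (Suc k) / real (Suc k) powr p" for k n
  proof (cases "k < n")
    case True
    then have "real n powr (- p) \<le> real (Suc k) powr (- p)"
      using p by (intro powr_mono2') auto
    then have "real n powr (- p) * a (Suc k) \<le> real (Suc k) powr (- p) * a (Suc k)"
      using nonneg by (intro mult_right_mono) auto
    then show ?thesis
      using True nonneg[of "Suc k"] by (simp add: f_def powr_minus_divide)
  qed (use nonneg in \<open>simp add: f_def\<close>)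
  have "(\<lambda>n. \<Sum>k. f k n) \<longlonglongrightarrow> (\<Sum>k. 0)"
    using tannerys_theorem[where a = f, OF lim always_eventually summable] bound by auto
  moreover have "(\<Sum>k. f k n) = real n powr (- p) * (\<Sum>k=1..n. a k)" for n
  proof -
    have "(\<Sum>k. f k n) = (\<Sum>k<n. f k n)"
      by (intro suminf_finite) (auto simp: f_def)
    also have "\<dots> = real n powr (- p) * (\<Sum>k<n. a (Suc k))"
      by (simp add: f_def sum_distrib_left)
    also have "(\<Sum>k<n. a (Suc k)) = (\<Sum>k=1..n. a k)"
      by (simp add: sum.atLeast1_atMost_eq)
    finally show ?thesis .
  qed
  ultimately show ?thesis by simp
qed

section \<open>Adaptation times\<close>

text \<open>A nonempty infimum in \<open>enat\<close> is attained. This trades the infimum for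
  quantifiers over natural numbers, the form used both for finding the index of a change and for
  measurability.\<close>

lemma adaptation_time_Suc_eq_iff:
  "adaptation_time S (Suc j) \<omega> = enat k \<longleftrightarrow>
     S k \<omega> \<noteq> S (k - 1) \<omega> \<and>
     (\<exists>i<k. adaptation_time S j \<omega> = enat i \<and> (\<forall>l\<in>{i<..<k}. S l \<omega> = S (l - 1) \<omega>))"
    (is "?L \<longleftrightarrow> ?R")
proof
  let ?A = "{enat k | k. adaptation_time S j \<omega> < enat k \<and> S k \<omega> \<noteq> S (k - 1) \<omega>}"
  assume L: ?L
  then have inf: "Inf ?A = enat k" by simp
  \<comment> \<open>The empty set has infimum \<infinity>, which is not
    \<open>enat k\<close>.\<close>
  then have ne: "?A \<noteq> {}" by (metis Inf_empty enat.distinct(1) top_enat_def)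
  then have "(LEAST x. x \<in> ?A) \<in> ?A" by (meson LeastI_ex all_not_in_conv)
  then have "Inf ?A \<in> ?A" using ne by (simp only: Inf_enat_def if_False)
  then have k: "adaptation_time S j \<omega> < enat k" "S k \<omega> \<noteq> S (k - 1) \<omega>"
    using inf by auto
  then obtain i where i: "adaptation_time S j \<omega> = enat i"
    by (cases "adaptation_time S j \<omega>") auto
  have "S l \<omega> = S (l - 1) \<omega>" if "l \<in> {i<..<k}" for l
  proof (rule ccontr)
    assume "S l \<omega> \<noteq> S (l - 1) \<omega>"
    then have "Inf ?A \<le> enat l" using that i by (intro Inf_lower) auto
    then show False using inf that by simp
  qed
  then show ?R using k i by auto
next
  let ?A = "{enat k | k. adaptation_time S j \<omega> < enat k \<and> S k \<omega> \<noteq> S (k - 1) \<omega>}"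
  assume ?R
  then obtain i where i: "i < k" "S k \<omega> \<noteq> S (k - 1) \<omega>" "adaptation_time S j \<omega> = enat i"
    "\<forall>l\<in>{i<..<k}. S l \<omega> = S (l - 1) \<omega>" by blast
  have "Inf ?A = enat k"
  proof (rule antisym)
    show "Inf ?A \<le> enat k" using i by (intro Inf_lower) auto
    show "enat k \<le> Inf ?A"
    proof (rule Inf_greatest)
      fix t assume "t \<in> ?A"
      then obtain l where l: "t = enat l" "i < l" "S l \<omega> \<noteq> S (l - 1) \<omega>"
        using i(3) by auto
      then have "\<not> l < k" using i(4) by (metis greaterThanLessThan_iff)
      then show "enat k \<le> t" using l by simp
    qed
  qed
  then show ?L by simp
qed

text \<open>Strong induction: if no change precedes \<open>k\<close>, then \<open>k\<close> is the
  first adaptation time. Otherwise the last change \<open>m\<close> before \<open>k\<close> is an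
  adaptation time by induction, and \<open>k\<close> is the next one.\<close>

lemma ex_adaptation_time_eq:
  assumes "S k \<omega> \<noteq> S (k - 1) \<omega>"
  shows "\<exists>j. adaptation_time S (Suc j) \<omega> = enat k"
  using assms
proof (induction k rule: less_induct)
  case (less k)
  \<comment> \<open>At index 0 truncated subtraction gives \<open>0 - 1 = 0\<close>, so no change
    occurs there.\<close>
  have "k > 0" using less.prems by (cases k) auto
  let ?B = "{l. l < k \<and> S l \<omega> \<noteq> S (l - 1) \<omega>}"
  show ?case
  proof (cases "?B = {}")
    case True
    have "adaptation_time S 0 \<omega> = enat 0" by (simp add: zero_enat_def)
    moreover have "S l \<omega> = S (l - 1) \<omega>" if "l \<in> {0<..<k}" for l
    proof -
      have "l \<notin> ?B" by (simp only: True empty_iff not_False_eq_True)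
      then show ?thesis using that by simp
    qed
    ultimately have "adaptation_time S (Suc 0) \<omega> = enat k"
      using less.prems \<open>k > 0\<close> unfolding adaptation_time_Suc_eq_iff by metis
    then show ?thesis by blast
  next
    case False
    define m where "m = Max ?B"
    have "m \<in> ?B" unfolding m_def using False by (intro Max_in) auto
    then have m: "m < k" "S m \<omega> \<noteq> S (m - 1) \<omega>" by auto
    then obtain j where j: "adaptation_time S (Suc j) \<omega> = enat m"
      using less.IH by blast
    have "S l \<omega> = S (l - 1) \<omega>" if "l \<in> {m<..<k}" for l
    proof (rule ccontr)
      assume "S l \<omega> \<noteq> S (l - 1) \<omega>"
      then have "l \<le> m" unfolding m_def using that by (intro Max_ge) auto
      then show False using that by simp
    qed
    then have "\<forall>l\<in>{m<..<k}. S l \<omega> = S (l - 1) \<omega>" by (rule ballI)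
    with less.prems m(1) j have "adaptation_time S (Suc (Suc j)) \<omega> = enat k"
      by (subst adaptation_time_Suc_eq_iff) (intro conjI exI[of _ m])
    then show ?thesis by blast
  qed
qed

lemma suminf_changes_le_suminf_adaptation_times:
  "(\<Sum>k. ennreal (of_bool (S (Suc k) \<omega> \<noteq> S k \<omega>) / real (Suc k) powr p))
     \<le> (\<Sum>j. ennreal (enat_neg_powr (adaptation_time S (Suc j) \<omega>) p))"
proof (rule suminf_le_const)
  fix n
  let ?A = "{k. k < n \<and> S (Suc k) \<omega> \<noteq> S k \<omega>}"
  have "\<exists>j. adaptation_time S (Suc j) \<omega> = enat (Suc k)" if "k \<in> ?A" for k
    using that ex_adaptation_time_eq[of S "Suc k" \<omega>] by auto
  then obtain J where J: "\<And>k. k \<in> ?A \<Longrightarrow> adaptation_time S (Suc (J k)) \<omega> = enat (Suc k)"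
    by metis
  \<comment> \<open>The adaptation time with index \<open>Suc (J k)\<close> is \<open>Suc k\<close>,
    so \<open>J k\<close> determines \<open>k\<close>. The left partial sum thus becomes a subsum of
    the right-hand series, whose other terms are nonnegative.\<close>
  have inj: "inj_on J ?A"
    by (rule inj_onI) (metis J enat.inject nat.inject)
  have "(\<Sum>k<n. ennreal (of_bool (S (Suc k) \<omega> \<noteq> S k \<omega>) / real (Suc k) powr p))
      = (\<Sum>k\<in>?A. ennreal (1 / real (Suc k) powr p))"
    by (intro sum.mono_neutral_cong_right) auto
  also have "\<dots> = (\<Sum>k\<in>?A. ennreal (enat_neg_powr (adaptation_time S (Suc (J k)) \<omega>) p))"
    using J by (intro sum.cong refl)
      (simp add: enat_neg_powr_def powr_minus_divide del: adaptation_time.simps)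
  also have "\<dots> = (\<Sum>j\<in>J ` ?A. ennreal (enat_neg_powr (adaptation_time S (Suc j) \<omega>) p))"
    by (simp add: sum.reindex[OF inj] del: adaptation_time.simps)
  also have "\<dots> \<le> (\<Sum>j. ennreal (enat_neg_powr (adaptation_time S (Suc j) \<omega>) p))"
    by (intro sum_le_suminf) auto
  finally show "(\<Sum>k<n. ennreal (of_bool (S (Suc k) \<omega> \<noteq> S k \<omega>) / real (Suc k) powr p))
      \<le> (\<Sum>j. ennreal (enat_neg_powr (adaptation_time S (Suc j) \<omega>) p))" .
qed simp

text \<open>Since \<open>enat\<close> is countable, level sets suffice. Finite levels follow by
  induction on \<open>j\<close> from the quantifier characterization; the level \<infinity> is the
  complement of all finite ones.\<close>

lemma measurable_adaptation_time:
  assumes change: "\<And>k. k \<ge> 1 \<Longrightarrow> change_event M S k \<in> sets M"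
  shows "adaptation_time S j \<in> M \<rightarrow>\<^sub>M count_space UNIV"
proof -
  have [measurable]: "Measurable.pred M (\<lambda>\<omega>. S k \<omega> = S (k - 1) \<omega>)" for k
  proof (cases "k = 0")
    case False
    have "{\<omega> \<in> space M. S k \<omega> = S (k - 1) \<omega>} = space M - change_event M S k"
      by (auto simp: change_event_def)
    then show ?thesis using change[of k] False by (simp add: pred_def)
  qed simp
  have fin: "Measurable.pred M (\<lambda>\<omega>. adaptation_time S j \<omega> = enat k)" for k
  proof (induction j arbitrary: k)
    case (Suc j)
    note [measurable] = Suc.IH
    show ?case unfolding adaptation_time_Suc_eq_iff by measurable
  qed simp
  have "Measurable.pred M (\<lambda>\<omega>. adaptation_time S j \<omega> = t)" for t
  proof (cases t)
    case infinity
    have "Measurable.pred M (\<lambda>\<omega>. \<forall>k. adaptation_time S j \<omega> \<noteq> enat k)"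
      using fin by measurable
    also have "(\<lambda>\<omega>. \<forall>k. adaptation_time S j \<omega> \<noteq> enat k) = (\<lambda>\<omega>. adaptation_time S j \<omega> = t)"
      using infinity by (metis enat.exhaust enat.distinct(1))
    finally show ?thesis .
  qed (use fin in simp)
  then show ?thesis
    by (subst measurable_count_space_eq2_countable)
      (auto simp: pred_def vimage_def Int_def conj_commute)
qed

section \<open>Total variation bounds\<close>

lemma tv_dist_le_1:
  assumes "prob_space \<mu>" "prob_space \<nu>"
  shows "tv_dist \<mu> \<nu> \<le> 1"
  unfolding tv_dist_def
proof (rule cSUP_least)
  fix A
  show "\<bar>measure \<mu> A - measure \<nu> A\<bar> \<le> 1"
    using prob_space.prob_le_1[OF assms(1), of A] prob_space.prob_le_1[OF assms(2), of A]
      measure_nonneg[of \<mu> A] measure_nonneg[of \<nu> A] by linarith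
qed auto

lemma tv_dist_self: "tv_dist \<mu> \<mu> = 0"
proof -
  \<comment> \<open>A real supremum of the constant 0 is known to be 0 only over a nonempty index
    set.\<close>
  have "sets \<mu> \<noteq> {}" by auto
  then show ?thesis by (simp add: tv_dist_def)
qed

context adaptive_process
begin

lemma
  assumes "\<omega> \<in> space M"
  shows S_space: "S k \<omega> \<in> space SS" and X_space: "X k \<omega> \<in> space XX"
  using measurable_space[OF adapted, of \<omega> k] F_subalgebra[of k] assms
  by (auto simp: subalgebra_def space_pair_measure)

lemma prob_space_kernel: "s \<in> space SS \<Longrightarrow> x \<in> space XX \<Longrightarrow> prob_space (P s x)"
  using measurable_space[OF kernel] by (auto simp: space_prob_algebra)

text \<open>Without a change the two kernels coincide and the distance is 0; with a change the
  trivial bound 1 suffices.\<close>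

lemma SUP_tv_dist_le_change:
  assumes "\<omega> \<in> space M"
  shows "(SUP x\<in>space XX. tv_dist (P (S k \<omega>) x) (P (S (k - 1) \<omega>) x))
           \<le> indicator (change_event M S k) \<omega>"
proof (rule cSUP_least)
  \<comment> \<open>The state \<open>X k \<omega>\<close> is a witness.\<close>
  show "space XX \<noteq> {}" using X_space[OF assms] by auto
  show "tv_dist (P (S k \<omega>) x) (P (S (k - 1) \<omega>) x) \<le> indicator (change_event M S k) \<omega>"
    if "x \<in> space XX" for x
  proof (cases "S k \<omega> = S (k - 1) \<omega>")
    case False
    then show ?thesis
      using tv_dist_le_1[OF prob_space_kernel prob_space_kernel] S_space[OF assms] assms that
      by (simp add: change_event_def)
  qed (simp add: tv_dist_self)
qed

section \<open>Expected weighted number of changes\<close>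

text \<open>Common target of both hypotheses: a finite integral makes the series finite almost
  surely, and Kronecker's lemma then applies path by path.\<close>

lemma strongly_waning_if_nn_integral_finite:
  assumes p: "p > 0"
    and fin: "(\<integral>\<^sup>+ \<omega>. (\<Sum>k. ennreal (indicator (change_event M S (Suc k)) \<omega> / real (Suc k) powr p)) \<partial>M)
                < \<infinity>"
  shows "strongly_waning M XX P S p"
proof -
  have [measurable]: "change_event M S (Suc k) \<in> sets M" for k
    by (rule change_measurable) simp
  have "AE \<omega> in M. (\<Sum>k. ennreal (indicator (change_event M S (Suc k)) \<omega> / real (Suc k) powr p)) \<noteq> \<infinity>"
    by (rule nn_integral_PInf_AE) (use fin in auto)
  then have lim: "AE \<omega> in M. (\<lambda>n. real n powr (- p)
      * (\<Sum>k=1..n. indicator (change_event M S k) \<omega>)) \<longlonglongrightarrow> 0"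
  proof eventually_elim
    case (elim \<omega>)
    have "summable (\<lambda>k. indicator (change_event M S (Suc k)) \<omega> / real (Suc k) powr p)"
      by (rule summable_suminf_not_top) (use elim in auto)
    then show ?case
      by (intro kronecker_powr_nonneg p) auto
  qed
  show ?thesis
    unfolding strongly_waning_def
    by (rule exI[of _ "\<lambda>k. indicator (change_event M S k)"])
      (use change_measurable SUP_tv_dist_le_change lim in auto)
qed

lemma nn_integral_suminf_changes:
  "(\<integral>\<^sup>+ \<omega>. (\<Sum>k. ennreal (indicator (change_event M S (Suc k)) \<omega> / real (Suc k) powr p)) \<partial>M)
     = (\<Sum>k. ennreal (prob (change_event M S (Suc k)) / real (Suc k) powr p))"
proof -
  have [measurable]: "change_event M S (Suc k) \<in> sets M" for k
    by (rule change_measurable) simp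
  have "(\<integral>\<^sup>+ \<omega>. ennreal (indicator (change_event M S (Suc k)) \<omega> / real (Suc k) powr p) \<partial>M)
      = ennreal (prob (change_event M S (Suc k)) / real (Suc k) powr p)" for k
    by (subst nn_integral_eq_integral) (auto simp: less_top[symmetric])
  then show ?thesis by (subst nn_integral_suminf) auto
qed

lemma nn_integral_changes_le_adaptation_times:
  "(\<integral>\<^sup>+ \<omega>. (\<Sum>k. ennreal (indicator (change_event M S (Suc k)) \<omega> / real (Suc k) powr p)) \<partial>M)
     \<le> (\<Sum>j. \<integral>\<^sup>+ \<omega>. ennreal (enat_neg_powr (adaptation_time S (Suc j) \<omega>) p) \<partial>M)"
proof -
  have meas: "(\<lambda>\<omega>. ennreal (enat_neg_powr (adaptation_time S j \<omega>) p)) \<in> borel_measurable M" for j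
    \<comment> \<open>Every function on a discrete space is measurable, so nothing about
      \<open>enat_neg_powr\<close> has to be checked.\<close>
    by (rule measurable_compose[OF measurable_adaptation_time[OF change_measurable]]) auto
  have "(\<integral>\<^sup>+ \<omega>. (\<Sum>k. ennreal (indicator (change_event M S (Suc k)) \<omega> / real (Suc k) powr p)) \<partial>M)
      = (\<integral>\<^sup>+ \<omega>. (\<Sum>k. ennreal (of_bool (S (Suc k) \<omega> \<noteq> S k \<omega>) / real (Suc k) powr p)) \<partial>M)"
    by (intro nn_integral_cong) (simp add: change_event_def indicator_def of_bool_def)
  also have "\<dots> \<le> (\<integral>\<^sup>+ \<omega>. (\<Sum>j. ennreal (enat_neg_powr (adaptation_time S (Suc j) \<omega>) p)) \<partial>M)"
    by (intro nn_integral_mono suminf_changes_le_suminf_adaptation_times)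
  also have "\<dots> = (\<Sum>j. \<integral>\<^sup>+ \<omega>. ennreal (enat_neg_powr (adaptation_time S (Suc j) \<omega>) p) \<partial>M)"
    by (intro nn_integral_suminf meas)
  finally show ?thesis .
qed

end

theorem lemma19:
  fixes M :: "'w measure" and F :: "nat \<Rightarrow> 'w measure"
    and XX :: "'x measure" and SS :: "'s measure"
    and \<pi> :: "'x measure" and P :: "'s \<Rightarrow> 'x \<Rightarrow> 'x measure"
    and S :: "nat \<Rightarrow> 'w \<Rightarrow> 's" and X :: "nat \<Rightarrow> 'w \<Rightarrow> 'x"
    and p :: real
  assumes "adaptive_process M F XX SS \<pi> P S X"
    and "p > 0"
    and "summable (\<lambda>k. measure M (change_event M S (Suc k)) / real (Suc k) powr p)
       \<or> (\<Sum>j. \<integral>\<^sup>+ \<omega>. ennreal (enat_neg_powr (adaptation_time S (Suc j) \<omega>) p) \<partial>M) < \<infinity>"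
  shows "strongly_waning M XX P S p"
proof -
  interpret adaptive_process M F XX SS \<pi> P S X by fact
  show ?thesis
  \<comment> \<open>By Tonelli, the series in the first hypothesis is exactly the integral to be
    bounded, while the series in the second one majorizes it.\<close>
  proof (rule strongly_waning_if_nn_integral_finite[OF assms(2)])
    show "(\<integral>\<^sup>+ \<omega>. (\<Sum>k. ennreal (indicator (change_event M S (Suc k)) \<omega> / real (Suc k) powr p)) \<partial>M)
            < \<infinity>"
      using assms(3)
    proof
      assume "summable (\<lambda>k. prob (change_event M S (Suc k)) / real (Suc k) powr p)"
      then have "(\<Sum>k. ennreal (prob (change_event M S (Suc k)) / real (Suc k) powr p)) \<noteq> top"
        by (rule ennreal_suminf_neq_top) simp
      then show ?thesis by (simp only: nn_integral_suminf_changes less_top infinity_ennreal_def)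
    next
      assume "(\<Sum>j. \<integral>\<^sup>+ \<omega>. ennreal (enat_neg_powr (adaptation_time S (Suc j) \<omega>) p) \<partial>M) < \<infinity>"
      with nn_integral_changes_le_adaptation_times show ?thesis by (rule le_less_trans)
    qed
  qed
qed

end
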